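(* Fix $\alpha>0$ and let $X=\{(\lambda,m_\lambda)\}_{\lambda\in\Lambda}$ denote a divisor. (a) If $X$ is a sampling divisor for $\mathcal F^\infty_\alpha$, then there exists $C>0$ such that $$\bigcup_{\lambda\in\Lambda} D(\lambda,\sqrt{m_\lambda/\alpha}+C)=\mathbb C.$$ (b) Conversely, if for some $C>0$ and a compact set $K\subset\mathbb C$ we have $$\bigcup_{\lambda\in\Lambda,\ m_\lambda>\alpha C^2} D(\lambda,\sqrt{m_\lambda/\alpha}-C)=\mathbb C\setminus K,$$ then $X$ is a sampling divisor for $\mathcal F^\infty_\alpha$.
   Context: $D(z,r)$ is the open disc of radius $r$ centered at $z\in\mathbb C$. For $\alpha>0$, $\mathcal F^\infty_\alpha$ is the Banach space of entire functions $f$ with $\|f\|_{\alpha,\infty}=\sup_{z\in\mathbb C}|f(z)|e^{-\frac{\alpha}{2}|z|^2}<\infty$. A divisor is $X=\{(\lambda,m_\lambda)\}_{\lambda\in\Lambda}$, where $\Lambda$ is a sequence of (distinct) points in $\mathbb C$ and $m_\lambda\in\{1,2,3,\dots\}$ is the multiplicity associated with $\lambda$. Put $N^\infty_\lambda=\{f\in\mathcal F^\infty_\alpha: f(\lambda)=f'(\lambda)=\dots=f^{(m_\lambda-1)}(\lambda)=0\}$, and let $\|f\|_{\mathcal F^\infty_\alpha/N^\infty_\lambda}=\inf_{g\in N^\infty_\lambda}\|f-g\|_{\alpha,\infty}$ be the quotient norm. $X$ is called sampling for $\mathcal F^\infty_\alpha$ if there exists $L>0$ such that $\|f\|_{\alpha,\infty}\le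 L\sup_{\lambda\in\Lambda}\|f\|_{\mathcal F^\infty_\alpha/N^\infty_\lambda}$ for all $f\in\mathcal F^\infty_\alpha$. *)

theory Defs
  imports "HOL-Complex_Analysis.Complex_Analysis"
begin

text \<open>The (weighted) norms take values in \<^typ>\<open>ennreal\<close>, so that all suprema and infima below
  exist unconditionally; in particular the supremum of the empty set is \<open>0\<close>.\<close>

definition fock_norm :: "real \<Rightarrow> (complex \<Rightarrow> complex) \<Rightarrow> ennreal" where
  "fock_norm \<alpha> f = (SUP z. ennreal (cmod (f z) * exp (- (\<alpha> / 2) * (cmod z)\<^sup>2)))"

definition fock_space :: "real \<Rightarrow> (complex \<Rightarrow> complex) set" where
  "fock_space \<alpha> = {f. f holomorphic_on UNIV \<and> fock_norm \<alpha> f < \<infinity>}"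

text \<open>A divisor is given by its set \<open>\<Lambda>\<close> of points and a multiplicity function \<open>m\<close>, of which only
  the values on \<open>\<Lambda>\<close> matter. A sequence of distinct points is rendered as a countable set; it may be
  finite and is not required to be discrete.\<close>

definition divisor :: "complex set \<Rightarrow> (complex \<Rightarrow> nat) \<Rightarrow> bool" where
  "divisor \<Lambda> m \<longleftrightarrow> countable \<Lambda> \<and> (\<forall>l\<in>\<Lambda>. 1 \<le> m l)"

definition vanishing_subspace :: "real \<Rightarrow> complex \<Rightarrow> nat \<Rightarrow> (complex \<Rightarrow> complex) set" where
  "vanishing_subspace \<alpha> l n = {f \<in> fock_space \<alpha>. \<forall>k<n. (deriv ^^ k) f l = 0}"

definition fock_quotient_norm ::
    "real \<Rightarrow> complex \<Rightarrow> nat \<Rightarrow> (complex \<Rightarrow> complex) \<Rightarrow> ennreal" where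
  "fock_quotient_norm \<alpha> l n f = (INF g\<in>vanishing_subspace \<alpha> l n. fock_norm \<alpha> (\<lambda>z. f z - g z))"

definition sampling_divisor :: "real \<Rightarrow> complex set \<Rightarrow> (complex \<Rightarrow> nat) \<Rightarrow> bool" where
  "sampling_divisor \<alpha> \<Lambda> m \<longleftrightarrow>
     (\<exists>L>0::real. \<forall>f\<in>fock_space \<alpha>.
        fock_norm \<alpha> f \<le> ennreal L * (SUP l\<in>\<Lambda>. fock_quotient_norm \<alpha> l (m l) f))"

end

theory Submission
  imports Defs
begin

text \<open>Write \<open>\<rho> = sqrt (m l / \<alpha>)\<close>.

  (a) A point \<open>w\<close> at distance at least \<open>\<rho> + C\<close> from every \<open>l\<close> is tested with the normalised
  reproducing kernel at \<open>w\<close>. Modulo functions vanishing to order \<open>m l\<close> at \<open>l\<close> it is a Taylor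
  polynomial in the coordinate at \<open>l\<close>, and a Chernoff type bound for the partial sums of \<open>exp\<close> makes
  its norm at most \<open>exp (- \<alpha> / 2 * C\<^sup>2)\<close>.

  (b) By the maximum principle a function vanishing to order \<open>m l\<close> at \<open>l\<close> is, at depth \<open>d\<close> inside
  the disc of radius \<open>\<rho>\<close>, smaller than its norm by the factor \<open>exp (- \<alpha> / 2 * d\<^sup>2)\<close>. If \<open>X\<close> is not
  sampling, Montel's theorem therefore yields a nonzero limit \<open>g\<close> with all the zeros of \<open>X\<close> whose
  weighted modulus attains its maximum at some \<open>p \<in> K\<close>; in particular \<open>p\<close> lies in none of the discs of
  radius \<open>\<rho>\<close>. Multiplying the weight by \<open>exp (s * t - \<eta> / 2 * t\<^sup>2)\<close>, \<open>t = ln (dist p z)\<close>, costs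
  less than is gained on these discs when \<open>\<eta>\<close> is small, so the new supremum is still controlled by \<open>K\<close>. For
  large \<open>s\<close> this is absurd, since the factor then favours points outside \<open>K\<close>.\<close>

subsection \<open>Zeros of entire functions and the maximum principle\<close>

text \<open>The tail of the Taylor series at \<open>a\<close>, divided by
  \<open>(z - a) ^ n\<close>, still converges everywhere and so is entire. If \<open>f\<close>
  vanishes to order \<open>n\<close> at \<open>a\<close>, the sum disappears and
  \<open>(z - a) ^ n\<close> factors out; zeros are used in this form throughout.\<close>

lemma entire_taylor_remainder:
  fixes f :: "complex \<Rightarrow> complex"
  assumes "f holomorphic_on UNIV"
  obtains q where "q holomorphic_on UNIV"
    "\<And>z. f z = (\<Sum>k<n. (deriv ^^ k) f a / fact k * (z - a) ^ k) + (z - a) ^ n * q z"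
proof -
  define c where "c k = (deriv ^^ k) f a / fact k" for k
  define q where "q z = (\<Sum>k. c (k + n) * (z - a) ^ k)" for z
  have f_sums: "(\<lambda>k. c k * (z - a) ^ k) sums f z" for z
    unfolding c_def
    by (rule holomorphic_power_series[of _ _ "dist a z + 1"])
      (use assms in \<open>auto intro: holomorphic_on_subset\<close>)
  have tail: "(\<lambda>k. c (k + n) * (z - a) ^ (k + n)) sums (f z - (\<Sum>k<n. c k * (z - a) ^ k))" for z
    using sums_split_initial_segment[OF f_sums[of z], of n] by simp
  have q_sums: "(\<lambda>k. c (k + n) * (z - a) ^ k) sums q z" for z
  proof -
    have "summable (\<lambda>k. c (k + n) * (z - a) ^ k)"
    proof (cases "z = a")
      case True
      then show ?thesis
        by (intro summable_finite[of "{0}"]) auto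
    next
      case False
      have "summable (\<lambda>k. c (k + n) * (z - a) ^ (k + n) / (z - a) ^ n)"
        using sums_summable[OF tail] by (rule summable_divide)
      then show ?thesis
        using False by (simp add: power_add)
    qed
    then show ?thesis
      unfolding q_def by (rule summable_sums)
  qed
  have "q field_differentiable (at z)" for z
  proof -
    have "q holomorphic_on ball a (dist a z + 1)"
      by (rule power_series_holomorphic) (rule q_sums)
    then show ?thesis
      by (rule holomorphic_on_imp_differentiable_at) auto
  qed
  then have "q holomorphic_on UNIV"
    by (auto simp: holomorphic_on_def intro: field_differentiable_at_within)
  moreover have "f z = (\<Sum>k<n. c k * (z - a) ^ k) + (z - a) ^ n * q z" for z
  proof -
    have "(\<lambda>k. (z - a) ^ n * (c (k + n) * (z - a) ^ k)) sums ((z - a) ^ n * q z)"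
      using q_sums by (rule sums_mult)
    then have "(z - a) ^ n * q z = f z - (\<Sum>k<n. c k * (z - a) ^ k)"
      using tail[of z] by (intro sums_unique2) (simp_all add: power_add mult_ac)
    then show ?thesis by simp
  qed
  ultimately show thesis
    by (intro that[of q]) (simp_all add: c_def)
qed

text \<open>Differentiating once leaves \<open>(z - a) ^ (n - 1)\<close> times another entire
  function, so the induction runs with \<open>q\<close> and \<open>n\<close> kept general.\<close>

lemma higher_deriv_power_mult_eq_0:
  fixes q :: "complex \<Rightarrow> complex"
  assumes "q holomorphic_on UNIV" "k < n"
  shows "(deriv ^^ k) (\<lambda>z. (z - a) ^ n * q z) a = 0"
  using assms
proof (induction k arbitrary: n q)
  case 0
  then show ?case by simp
next
  case (Suc k)
  then obtain n' where n: "n = Suc n'" "k < n'"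
    by (cases n) auto
  have q': "(q has_field_derivative deriv q z) (at z)" for z
    using Suc.prems(1) by (metis UNIV_I holomorphic_derivI open_UNIV)
  have power': "((\<lambda>z. (z - a) ^ n) has_field_derivative of_nat n * (z - a) ^ n') (at z)" for z
    using DERIV_power[of "\<lambda>z. z - a" 1 z UNIV n] n(1)
    by (simp add: DERIV_diff[OF DERIV_ident DERIV_const, simplified])
  have "deriv (\<lambda>z. (z - a) ^ n * q z) = (\<lambda>z. (z - a) ^ n' * (of_nat n * q z + (z - a) * deriv q z))"
    using DERIV_mult[OF power' q'] by (intro ext DERIV_imp_deriv) (simp add: n(1) algebra_simps)
  moreover have "(\<lambda>z. of_nat n * q z + (z - a) * deriv q z) holomorphic_on UNIV"
    using Suc.prems(1) by (intro holomorphic_intros holomorphic_deriv) auto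
  ultimately show ?case
    using Suc.IH[OF _ n(2)] by (simp add: funpow_Suc_right del: funpow.simps)
qed

text \<open>The pointwise real quantity whose supremum is \<open>fock_norm\<close>. Estimates are
  made in the reals and transferred to \<open>ennreal\<close> by
  \<open>fock_norm_le_iff\<close>.\<close>

definition fock_weight :: "real \<Rightarrow> (complex \<Rightarrow> complex) \<Rightarrow> complex \<Rightarrow> real" where
  "fock_weight \<alpha> f z = cmod (f z) * exp (- (\<alpha> / 2) * (cmod z)\<^sup>2)"

lemma fock_weight_nonneg: "0 \<le> fock_weight \<alpha> f z"
  by (simp add: fock_weight_def)

lemma fock_weight_eq_0_iff: "fock_weight \<alpha> f z = 0 \<longleftrightarrow> f z = 0"
  by (simp add: fock_weight_def)

lemma fock_norm_le_iff:
  assumes "0 \<le> B"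
  shows "fock_norm \<alpha> f \<le> ennreal B \<longleftrightarrow> (\<forall>z. fock_weight \<alpha> f z \<le> B)"
  using assms by (simp add: fock_norm_def SUP_le_iff fock_weight_def)

lemma fock_weight_add_le: "fock_weight \<alpha> (\<lambda>z. f z + g z) z \<le> fock_weight \<alpha> f z + fock_weight \<alpha> g z"
  by (simp add: fock_weight_def norm_triangle_ineq flip: distrib_right)

lemma fock_spaceI:
  assumes "f holomorphic_on UNIV" "\<And>z. fock_weight \<alpha> f z \<le> B"
  shows "f \<in> fock_space \<alpha>"
proof -
  have "0 \<le> B"
    using assms(2) fock_weight_nonneg order_trans by blast
  then have "fock_norm \<alpha> f \<le> ennreal B"
    using assms(2) by (simp add: fock_norm_le_iff)
  then show ?thesis
    using assms(1) by (auto simp: fock_space_def intro: le_less_trans)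
qed

text \<open>Dividing by \<open>(z - a) ^ n\<close> and by the peak function \<open>exp (\<alpha> * cnj a * (z - a))\<close> turns the
  weight into a constant on circles around \<open>a\<close>, so that the maximum principle applies.\<close>

lemma fock_weight_disc_le:
  assumes "0 < \<alpha>" "0 < r" "r < R" "\<alpha> * r\<^sup>2 \<le> real n"
    and hol: "q holomorphic_on UNIV" "h holomorphic_on ball a R"
    and B: "\<And>z. dist a z = r \<Longrightarrow> fock_weight \<alpha> (\<lambda>z. (z - a) ^ n * q z) z * cmod (h z) \<le> B"
    and z: "dist a z \<le> r"
  shows "fock_weight \<alpha> (\<lambda>z. (z - a) ^ n * q z) z * cmod (h z) \<le> B * exp (- (\<alpha> / 2) * (r - dist a z)\<^sup>2)"
proof -
  define F where "F z = q z * h z * exp (- of_real \<alpha> * cnj a * (z - a))" for z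
  have weight: "fock_weight \<alpha> (\<lambda>z. (z - a) ^ n * q z) z * cmod (h z) =
      dist a z ^ n * cmod (F z) * exp (- (\<alpha> / 2) * ((cmod a)\<^sup>2 + (dist a z)\<^sup>2))" for z
  proof -
    have "(cmod z)\<^sup>2 = (cmod a)\<^sup>2 + (dist a z)\<^sup>2 + 2 * Re (cnj a * (z - a))"
      unfolding dist_norm cmod_power2 by (simp add: power2_eq_square algebra_simps)
    then have "exp (- (\<alpha> / 2) * (cmod z)\<^sup>2) =
        exp (- \<alpha> * Re (cnj a * (z - a))) * exp (- (\<alpha> / 2) * ((cmod a)\<^sup>2 + (dist a z)\<^sup>2))"
      by (simp only: exp_add [symmetric]) (simp add: algebra_simps)
    moreover have "cmod (exp (- of_real \<alpha> * cnj a * (z - a))) = exp (- \<alpha> * Re (cnj a * (z - a)))"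
      by (simp add: algebra_simps)
    ultimately show ?thesis
      by (simp add: fock_weight_def F_def norm_mult norm_power dist_norm norm_minus_commute)
  qed
  have F_holo: "F holomorphic_on ball a R"
    unfolding F_def using hol by (intro holomorphic_intros) (auto intro: holomorphic_on_subset)
  have F_bound: "cmod (F w) \<le> B / r ^ n * exp (\<alpha> / 2 * ((cmod a)\<^sup>2 + r\<^sup>2))" if "dist a w \<le> r" for w
  proof (rule maximum_modulus_frontier[of F "cball a r"])
    show "F holomorphic_on interior (cball a r)"
      using F_holo by (rule holomorphic_on_subset) (use \<open>r < R\<close> in auto)
    show "continuous_on (closure (cball a r)) F"
      using holomorphic_on_imp_continuous_on[OF F_holo]
      by (rule continuous_on_subset) (use \<open>r < R\<close> in auto)
    show "cmod (F z) \<le> B / r ^ n * exp (\<alpha> / 2 * ((cmod a)\<^sup>2 + r\<^sup>2))"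
      if "z \<in> frontier (cball a r)" for z
    proof -
      have z: "dist a z = r"
        using that by (simp add: frontier_cball)
      then have "r ^ n * cmod (F z) * exp (- (\<alpha> / 2) * ((cmod a)\<^sup>2 + r\<^sup>2)) \<le> B"
        using B[OF z] weight[of z] by simp
      then show ?thesis
        using \<open>0 < r\<close> by (simp add: exp_minus field_simps)
    qed
  qed (use that in auto)
  define x where "x = dist a z"
  have x: "0 \<le> x" "x \<le> r" using z by (auto simp: x_def)
  \<comment> \<open>The circle is nonempty, so \<open>B\<close> bounds some nonnegative
    value.\<close>
  have "dist a (a + of_real r) = r"
    using \<open>0 < r\<close> by (simp add: dist_norm)
  then have "0 \<le> B"
    using order_trans[OF mult_nonneg_nonneg[OF fock_weight_nonneg norm_ge_zero] B] by simp
  \<comment> \<open>This uses \<open>1 + u \<le> exp u\<close>. Since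
    \<open>x / r - 1 \<le> 0\<close>, the exponent \<open>n\<close> may then be lowered to
    \<open>\<alpha> * r\<^sup>2\<close>.\<close>
  have "(x / r) ^ n \<le> exp (x / r - 1) ^ n"
    using x \<open>0 < r\<close> exp_ge_add_one_self[of "x / r - 1"] by (intro power_mono) auto
  also have "\<dots> = exp (real n * (x / r - 1))"
    by (simp add: exp_of_nat_mult)
  also have "\<dots> \<le> exp (\<alpha> * r\<^sup>2 * (x / r - 1))"
    using x \<open>0 < r\<close> \<open>\<alpha> * r\<^sup>2 \<le> real n\<close> by (auto intro!: mult_right_mono_neg)
  finally have pow: "(x / r) ^ n \<le> exp (\<alpha> * r\<^sup>2 * (x / r - 1))" .
  have "x ^ n * cmod (F z) * exp (- (\<alpha> / 2) * ((cmod a)\<^sup>2 + x\<^sup>2)) \<le>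
      x ^ n * (B / r ^ n * exp (\<alpha> / 2 * ((cmod a)\<^sup>2 + r\<^sup>2))) * exp (- (\<alpha> / 2) * ((cmod a)\<^sup>2 + x\<^sup>2))"
    using F_bound[OF z] x by (intro mult_right_mono mult_left_mono) auto
  also have "\<dots> = B * (x / r) ^ n *
      (exp (\<alpha> / 2 * ((cmod a)\<^sup>2 + r\<^sup>2)) * exp (- (\<alpha> / 2) * ((cmod a)\<^sup>2 + x\<^sup>2)))"
    by (simp add: power_divide)
  also have "exp (\<alpha> / 2 * ((cmod a)\<^sup>2 + r\<^sup>2)) * exp (- (\<alpha> / 2) * ((cmod a)\<^sup>2 + x\<^sup>2)) =
      exp (\<alpha> / 2 * (r\<^sup>2 - x\<^sup>2))"
    by (simp only: exp_add [symmetric]) (simp add: algebra_simps)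
  also have "B * (x / r) ^ n * exp (\<alpha> / 2 * (r\<^sup>2 - x\<^sup>2)) \<le>
      B * exp (\<alpha> * r\<^sup>2 * (x / r - 1)) * exp (\<alpha> / 2 * (r\<^sup>2 - x\<^sup>2))"
    using pow \<open>0 \<le> B\<close> by (intro mult_right_mono mult_left_mono) auto
  also have "\<dots> = B * exp (\<alpha> * r\<^sup>2 * (x / r - 1) + \<alpha> / 2 * (r\<^sup>2 - x\<^sup>2))"
    by (simp add: exp_add)
  \<comment> \<open>The linear term completes the square and produces the Gaussian factor in the
    depth \<open>r - x\<close>.\<close>
  also have "\<alpha> * r\<^sup>2 * (x / r - 1) + \<alpha> / 2 * (r\<^sup>2 - x\<^sup>2) = - (\<alpha> / 2) * (r - x)\<^sup>2"
    using \<open>0 < r\<close> by (simp add: field_simps power2_eq_square)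
  finally show ?thesis
    using weight[of z] by (simp add: x_def)
qed

subsection \<open>Reproducing kernels\<close>

text \<open>Chernoff's trick: for \<open>k < n\<close> the factor \<open>s ^ k / s ^ n\<close> is at
  least 1, and inserting it turns the terms into those of the series for
  \<open>exp (s * x)\<close>.\<close>

lemma exp_partial_sum_le:
  fixes x s :: real
  assumes "0 \<le> x" "0 < s" "s \<le> 1"
  shows "(\<Sum>k<n. x ^ k / fact k) \<le> exp (s * x) / s ^ n"
proof -
  have "(\<Sum>k<n. x ^ k / fact k) \<le> (\<Sum>k<n. (s * x) ^ k / fact k / s ^ n)"
  proof (rule sum_mono)
    fix k assume "k \<in> {..<n}"
    then have "s ^ n \<le> s ^ k"
      using assms by (intro power_decreasing) auto
    then have "x ^ k / fact k * s ^ n \<le> x ^ k / fact k * s ^ k"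
      using assms by (intro mult_left_mono) auto
    then show "x ^ k / fact k \<le> (s * x) ^ k / fact k / s ^ n"
      using assms by (simp add: le_divide_eq power_mult_distrib mult_ac)
  qed
  also have "\<dots> = (\<Sum>k<n. (s * x) ^ k /\<^sub>R fact k) / s ^ n"
    by (simp add: divide_inverse_commute sum_distrib_left)
  also have "\<dots> \<le> exp (s * x) / s ^ n"
    unfolding exp_def using assms
    by (intro divide_right_mono sum_le_suminf summable_exp_generic) auto
  finally show ?thesis .
qed

text \<open>If \<open>R * r\<close> is at least \<open>\<rho>\<^sup>2\<close>, the truncation
  matters and the Chernoff bound is optimised. Otherwise \<open>r < \<rho>\<close>, hence
  \<open>R - r \<ge> C\<close>, and the full exponential series is already good enough.\<close>

lemma gaussian_partial_exp_le:
  fixes \<alpha> \<rho> C R r :: real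
  assumes "0 < \<alpha>" "0 < \<rho>" "0 \<le> C" "\<rho> + C \<le> R" "0 \<le> r" "\<alpha> * \<rho>\<^sup>2 = real n"
  shows "(\<Sum>k<n. (\<alpha> * R * r) ^ k / fact k) * exp (- (\<alpha> / 2) * (R\<^sup>2 + r\<^sup>2)) \<le> exp (- (\<alpha> / 2) * C\<^sup>2)"
proof (cases "\<rho>\<^sup>2 \<le> R * r")
  case True
  have "0 < R" using assms by simp
  have "0 < R * r" using True \<open>0 < \<rho>\<close> zero_less_power[of \<rho> 2] by linarith
  then have "0 < r" using \<open>0 < R\<close> by (simp add: zero_less_mult_iff)
  \<comment> \<open>The minimiser of \<open>exp (s * x) / s ^ n\<close> for
    \<open>x = \<alpha> * R * r\<close> is \<open>n / x\<close>; the case assumption makes it at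
    most 1.\<close>
  define s where "s = \<rho>\<^sup>2 / (R * r)"
  have s: "0 < s" "s \<le> 1"
    using True \<open>0 < R * r\<close> \<open>0 < \<rho>\<close> by (auto simp: s_def)
  have sx: "s * (\<alpha> * R * r) = real n"
    using \<open>0 < R\<close> \<open>0 < r\<close> assms(6) by (simp add: s_def mult_ac)
  \<comment> \<open>Bounding each factor \<open>u\<close> by \<open>exp (u - 1)\<close> separately
    makes the total exponent a sum of two squares, in \<open>R - \<rho>\<close> and
    \<open>r - \<rho>\<close>.\<close>
  have "1 / s ^ n = ((R / \<rho>) * (r / \<rho>)) ^ n"
    by (simp add: s_def power_divide power2_eq_square)
  also have "\<dots> \<le> (exp (R / \<rho> - 1) * exp (r / \<rho> - 1)) ^ n"
    using exp_ge_add_one_self[of "R / \<rho> - 1"] exp_ge_add_one_self[of "r / \<rho> - 1"]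
      \<open>0 < R\<close> \<open>0 < r\<close> \<open>0 < \<rho>\<close>
    by (intro power_mono mult_mono) auto
  also have "\<dots> = exp (real n * (R / \<rho> - 1 + (r / \<rho> - 1)))"
    by (simp only: exp_of_nat_mult exp_add)
  finally have s_pow: "1 / s ^ n \<le> exp (real n * (R / \<rho> - 1 + (r / \<rho> - 1)))" .
  have "(\<Sum>k<n. (\<alpha> * R * r) ^ k / fact k) \<le> exp (real n) * (1 / s ^ n)"
    using exp_partial_sum_le[of "\<alpha> * R * r" s n] s sx assms \<open>0 < R\<close> by simp
  also have "\<dots> \<le> exp (real n) * exp (real n * (R / \<rho> - 1 + (r / \<rho> - 1)))"
    using s_pow by (intro mult_left_mono) auto
  finally have "(\<Sum>k<n. (\<alpha> * R * r) ^ k / fact k) * exp (- (\<alpha> / 2) * (R\<^sup>2 + r\<^sup>2)) \<le>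
      exp (real n) * exp (real n * (R / \<rho> - 1 + (r / \<rho> - 1))) * exp (- (\<alpha> / 2) * (R\<^sup>2 + r\<^sup>2))"
    by (intro mult_right_mono) auto
  also have "\<dots> = exp (- (\<alpha> / 2) * ((R - \<rho>)\<^sup>2 + (r - \<rho>)\<^sup>2))"
    unfolding assms(6)[symmetric] using \<open>0 < \<rho>\<close>
    by (simp only: exp_add [symmetric]) (simp add: field_simps power2_eq_square)
  also have "\<dots> \<le> exp (- (\<alpha> / 2) * C\<^sup>2)"
  proof -
    have "C\<^sup>2 \<le> (R - \<rho>)\<^sup>2" using assms by (intro power_mono) auto
    then have "C\<^sup>2 \<le> (R - \<rho>)\<^sup>2 + (r - \<rho>)\<^sup>2"
      by (simp add: add_increasing2)
    then show ?thesis
      using \<open>0 < \<alpha>\<close> by simp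
  qed
  finally show ?thesis .
next
  case False
  have "\<rho> * r \<le> R * r" using assms by (intro mult_right_mono) auto
  then have "\<rho> * r < \<rho> * \<rho>" using False by (simp add: power2_eq_square)
  then have "r < \<rho>" using \<open>0 < \<rho>\<close> by simp
  have "(\<Sum>k<n. (\<alpha> * R * r) ^ k / fact k) * exp (- (\<alpha> / 2) * (R\<^sup>2 + r\<^sup>2)) \<le>
      exp (\<alpha> * R * r) * exp (- (\<alpha> / 2) * (R\<^sup>2 + r\<^sup>2))"
    using exp_partial_sum_le[of "\<alpha> * R * r" 1 n] assms by (intro mult_right_mono) auto
  also have "\<dots> = exp (- (\<alpha> / 2) * (R - r)\<^sup>2)"
    by (simp only: exp_add [symmetric]) (simp add: field_simps power2_eq_square)
  also have "\<dots> \<le> exp (- (\<alpha> / 2) * C\<^sup>2)"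
    using \<open>0 < \<alpha>\<close> assms \<open>r < \<rho>\<close> by (auto intro!: power_mono)
  finally show ?thesis .
qed

text \<open>The reproducing kernel at \<open>w\<close> divided by its norm; its weighted modulus is
  a Gaussian with peak value 1 at \<open>w\<close>.\<close>

definition fock_kernel :: "real \<Rightarrow> complex \<Rightarrow> complex \<Rightarrow> complex" where
  "fock_kernel \<alpha> w z = exp (of_real \<alpha> * cnj w * z - of_real (\<alpha> / 2 * (cmod w)\<^sup>2))"

lemma fock_weight_kernel: "fock_weight \<alpha> (fock_kernel \<alpha> w) z = exp (- (\<alpha> / 2) * (dist z w)\<^sup>2)"
proof -
  have "(dist z w)\<^sup>2 = (cmod z)\<^sup>2 + (cmod w)\<^sup>2 - 2 * Re (cnj w * z)"
    unfolding dist_norm cmod_power2 by (simp add: power2_eq_square algebra_simps)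
  then show ?thesis
    by (simp only: fock_weight_def fock_kernel_def norm_exp_eq_Re exp_add [symmetric])
      (simp add: algebra_simps)
qed

lemma fock_kernel_holomorphic: "fock_kernel \<alpha> w holomorphic_on A"
  unfolding fock_kernel_def by (intro holomorphic_intros)

lemma fock_kernel_in_fock_space:
  assumes "0 < \<alpha>"
  shows "fock_kernel \<alpha> w \<in> fock_space \<alpha>"
  using assms fock_kernel_holomorphic
  by (intro fock_spaceI[of _ _ 1]) (auto simp: fock_weight_kernel)

text \<open>The subtracted function is the kernel times the Taylor remainder of \<open>exp\<close>; what is left of
  the kernel is a Taylor polynomial of \<open>exp (\<alpha> * cnj (w - a) * (z - a))\<close> times the peak function at
  \<open>a\<close>.\<close>

lemma fock_quotient_norm_kernel_le:
  assumes "0 < \<alpha>" "1 \<le> n" "0 \<le> C" "sqrt (real n / \<alpha>) + C \<le> dist a w"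
  shows "fock_quotient_norm \<alpha> a n (fock_kernel \<alpha> w) \<le> ennreal (exp (- (\<alpha> / 2) * C\<^sup>2))"
proof -
  \<comment> \<open>Split \<open>cnj w * z\<close> as
    \<open>cnj a * z + cnj (w - a) * a + cnj (w - a) * (z - a)\<close>. The last term, times
    \<open>\<alpha>\<close>, is \<open>b * (z - a)\<close>; \<open>E\<close> collects the rest of
    the kernel's exponent.\<close>
  define b where "b = of_real \<alpha> * cnj (w - a)"
  define E where "E z = exp (of_real \<alpha> * cnj a * z + of_real \<alpha> * cnj (w - a) * a
    - of_real (\<alpha> / 2 * (cmod w)\<^sup>2))" for z
  define P where "P z = (\<Sum>k<n. (b * (z - a)) ^ k / fact k)" for z
  have "exp holomorphic_on UNIV"
    by (intro holomorphic_intros)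
  then obtain q where q: "q holomorphic_on UNIV"
    and exp_eq: "\<And>z. exp z = (\<Sum>k<n. (deriv ^^ k) exp 0 / fact k * (z - 0) ^ k) + (z - 0) ^ n * q z"
    by (rule entire_taylor_remainder[where a = 0 and n = n]) (rule that)
  have deriv_exp: "(deriv ^^ k) exp = (exp :: complex \<Rightarrow> complex)" for k
    by (induction k) (auto intro!: ext DERIV_imp_deriv DERIV_exp)
  define Q where "Q z = E z * (b ^ n * q (b * (z - a)))" for z
  have Q: "Q holomorphic_on UNIV"
  proof -
    have "q \<circ> (\<lambda>z. b * (z - a)) holomorphic_on UNIV"
      by (rule holomorphic_on_compose_gen[OF _ q]) (auto intro!: holomorphic_intros)
    then have "(\<lambda>z. q (b * (z - a))) holomorphic_on UNIV"
      by (simp add: o_def)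
    then show ?thesis
      unfolding Q_def E_def by (intro holomorphic_intros)
  qed
  have kernel_eq: "fock_kernel \<alpha> w z = E z * P z + (z - a) ^ n * Q z" for z
  proof -
    have "exp (b * (z - a)) = P z + (b * (z - a)) ^ n * q (b * (z - a))"
      using exp_eq[of "b * (z - a)"] by (simp add: P_def deriv_exp)
    moreover have "fock_kernel \<alpha> w z = E z * exp (b * (z - a))"
      by (simp add: fock_kernel_def E_def b_def algebra_simps flip: exp_add)
    ultimately show ?thesis
      by (simp add: Q_def power_mult_distrib distrib_left mult_ac)
  qed
  have E_weight: "cmod (E z) * exp (- (\<alpha> / 2) * (cmod z)\<^sup>2) =
      exp (- (\<alpha> / 2) * ((dist a w)\<^sup>2 + (dist a z)\<^sup>2))" for z
  proof -
    have "Re (of_real \<alpha> * cnj a * z + of_real \<alpha> * cnj (w - a) * a - of_real (\<alpha> / 2 * (cmod w)\<^sup>2))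
        + - (\<alpha> / 2) * (cmod z)\<^sup>2 = - (\<alpha> / 2) * ((dist a w)\<^sup>2 + (dist a z)\<^sup>2)"
      unfolding dist_norm cmod_power2 by (simp add: power2_eq_square field_simps)
    then show ?thesis
      by (simp only: E_def norm_exp_eq_Re exp_add [symmetric])
  qed
  have P_le: "cmod (P z) \<le> (\<Sum>k<n. (\<alpha> * dist a w * dist a z) ^ k / fact k)" for z
    unfolding P_def using \<open>0 < \<alpha>\<close>
    by (intro sum_norm_le)
      (simp add: b_def norm_mult norm_power norm_divide dist_norm norm_minus_commute
        del: complex_cnj_diff)
  have EP: "fock_weight \<alpha> (\<lambda>z. E z * P z) z \<le> exp (- (\<alpha> / 2) * C\<^sup>2)" for z
  proof -
    have "fock_weight \<alpha> (\<lambda>z. E z * P z) z =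
        cmod (P z) * exp (- (\<alpha> / 2) * ((dist a w)\<^sup>2 + (dist a z)\<^sup>2))"
      using E_weight[of z] by (simp add: fock_weight_def norm_mult)
    also have "\<dots> \<le> (\<Sum>k<n. (\<alpha> * dist a w * dist a z) ^ k / fact k) *
        exp (- (\<alpha> / 2) * ((dist a w)\<^sup>2 + (dist a z)\<^sup>2))"
      using P_le by (intro mult_right_mono) auto
    also have "\<dots> \<le> exp (- (\<alpha> / 2) * C\<^sup>2)"
      using assms by (intro gaussian_partial_exp_le[of _ "sqrt (real n / \<alpha>)"]) auto
    finally show ?thesis .
  qed
  have "(\<lambda>z. (z - a) ^ n * Q z) \<in> vanishing_subspace \<alpha> a n"
    unfolding vanishing_subspace_def
  proof (intro CollectI conjI allI impI)
    show "(\<lambda>z. (z - a) ^ n * Q z) \<in> fock_space \<alpha>"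
    proof (rule fock_spaceI)
      show "(\<lambda>z. (z - a) ^ n * Q z) holomorphic_on UNIV"
        using Q by (intro holomorphic_intros)
      \<comment> \<open>The remainder is the kernel minus \<open>E * P\<close>, and both of these
        have bounded weight.\<close>
      show "fock_weight \<alpha> (\<lambda>z. (z - a) ^ n * Q z) z \<le> 1 + exp (- (\<alpha> / 2) * C\<^sup>2)" for z
      proof -
        have "fock_weight \<alpha> (\<lambda>z. (z - a) ^ n * Q z) z =
            fock_weight \<alpha> (\<lambda>z. fock_kernel \<alpha> w z + - (E z * P z)) z"
          by (simp add: kernel_eq)
        also have "\<dots> \<le> fock_weight \<alpha> (fock_kernel \<alpha> w) z + fock_weight \<alpha> (\<lambda>z. - (E z * P z)) z"
          by (rule fock_weight_add_le)
        also have "\<dots> \<le> 1 + exp (- (\<alpha> / 2) * C\<^sup>2)"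
        proof (rule add_mono)
          show "fock_weight \<alpha> (fock_kernel \<alpha> w) z \<le> 1"
            using \<open>0 < \<alpha>\<close> by (simp add: fock_weight_kernel)
          show "fock_weight \<alpha> (\<lambda>z. - (E z * P z)) z \<le> exp (- (\<alpha> / 2) * C\<^sup>2)"
            using EP[of z] by (simp add: fock_weight_def)
        qed
        finally show ?thesis .
      qed
    qed
  qed (use Q in \<open>rule higher_deriv_power_mult_eq_0\<close>)
  then have "fock_quotient_norm \<alpha> a n (fock_kernel \<alpha> w) \<le>
      fock_norm \<alpha> (\<lambda>z. fock_kernel \<alpha> w z - (z - a) ^ n * Q z)"
    unfolding fock_quotient_norm_def by (rule INF_lower)
  also have "\<dots> \<le> ennreal (exp (- (\<alpha> / 2) * C\<^sup>2))"
    using EP by (simp add: fock_norm_le_iff kernel_eq)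
  finally show ?thesis .
qed

text \<open>The kernel at an uncovered point \<open>w\<close> has weight 1 at \<open>w\<close>, but
  all its quotient norms are at most \<open>exp (- \<alpha> / 2 * C\<^sup>2)\<close>. For large
  \<open>C\<close> this violates the sampling inequality.\<close>

lemma sampling_divisor_imp_covering:
  assumes "0 < \<alpha>" "divisor \<Lambda> m" "sampling_divisor \<alpha> \<Lambda> m"
  shows "\<exists>C>0. (\<Union>l\<in>\<Lambda>. ball l (sqrt (real (m l) / \<alpha>) + C)) = UNIV"
proof -
  obtain L :: real where "0 < L" and L: "\<And>f. f \<in> fock_space \<alpha> \<Longrightarrow>
      fock_norm \<alpha> f \<le> ennreal L * (SUP l\<in>\<Lambda>. fock_quotient_norm \<alpha> l (m l) f)"
    using assms(3) by (auto simp: sampling_divisor_def)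
  \<comment> \<open>Chosen to make the Gaussian factor \<open>exp (- L)\<close>, so that
    \<open>L < exp L\<close> finishes the argument.\<close>
  define C where "C = sqrt (2 * L / \<alpha>)"
  have "0 < C" using \<open>0 < L\<close> \<open>0 < \<alpha>\<close> by (simp add: C_def)
  have "\<alpha> / 2 * C\<^sup>2 = L"
    using \<open>0 < L\<close> \<open>0 < \<alpha>\<close> by (simp add: C_def)
  then have small: "L * exp (- (\<alpha> / 2) * C\<^sup>2) < 1"
    using exp_gt_self[of L] by (simp add: exp_minus field_simps)
  have "w \<in> (\<Union>l\<in>\<Lambda>. ball l (sqrt (real (m l) / \<alpha>) + C))" for w
  proof (rule ccontr)
    assume "w \<notin> (\<Union>l\<in>\<Lambda>. ball l (sqrt (real (m l) / \<alpha>) + C))"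
    then have "fock_quotient_norm \<alpha> l (m l) (fock_kernel \<alpha> w) \<le> ennreal (exp (- (\<alpha> / 2) * C\<^sup>2))"
      if "l \<in> \<Lambda>" for l
      using that assms(1,2) \<open>0 < C\<close>
      by (intro fock_quotient_norm_kernel_le) (auto simp: divisor_def not_less)
    \<comment> \<open>This covers an empty \<open>\<Lambda>\<close> too, where the supremum is
      0.\<close>
    then have "(SUP l\<in>\<Lambda>. fock_quotient_norm \<alpha> l (m l) (fock_kernel \<alpha> w))
        \<le> ennreal (exp (- (\<alpha> / 2) * C\<^sup>2))"
      by (rule SUP_least)
    then have "ennreal L * (SUP l\<in>\<Lambda>. fock_quotient_norm \<alpha> l (m l) (fock_kernel \<alpha> w))
        \<le> ennreal L * ennreal (exp (- (\<alpha> / 2) * C\<^sup>2))"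
      by (rule mult_left_mono) simp
    then have "fock_norm \<alpha> (fock_kernel \<alpha> w) \<le> ennreal (L * exp (- (\<alpha> / 2) * C\<^sup>2))"
      using L[OF fock_kernel_in_fock_space[OF assms(1)], of w] \<open>0 < L\<close>
      by (simp add: ennreal_mult order_trans)
    then have "fock_weight \<alpha> (fock_kernel \<alpha> w) w \<le> L * exp (- (\<alpha> / 2) * C\<^sup>2)"
      using \<open>0 < L\<close> by (simp add: fock_norm_le_iff)
    then show False
      using small by (simp add: fock_weight_kernel)
  qed
  then show ?thesis
    using \<open>0 < C\<close> by blast
qed

subsection \<open>Uniqueness\<close>

text \<open>The case \<open>h = 1\<close> of \<open>fock_weight_disc_le\<close>, at the largest
  admissible radius, where \<open>\<alpha> * r\<^sup>2 = n\<close>.\<close>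

lemma fock_weight_centre_le:
  assumes "0 < \<alpha>" "1 \<le> n" "q holomorphic_on UNIV"
    and B: "\<And>z. fock_weight \<alpha> (\<lambda>z. (z - a) ^ n * q z) z \<le> B"
    and z: "dist a z \<le> sqrt (real n / \<alpha>)"
  shows "fock_weight \<alpha> (\<lambda>z. (z - a) ^ n * q z) z \<le>
    B * exp (- (\<alpha> / 2) * (sqrt (real n / \<alpha>) - dist a z)\<^sup>2)"
  using fock_weight_disc_le[of \<alpha> "sqrt (real n / \<alpha>)" "sqrt (real n / \<alpha>) + 1" n q "\<lambda>_. 1" a B z] assms
  by simp

text \<open>With \<open>t = ln (dist p z)\<close>, the factor \<open>exp (s * t - \<eta> / 2 * t\<^sup>2)\<close> vanishes both at \<open>p\<close> and at
  infinity. On a disc that avoids \<open>p\<close> it is, up to \<open>exp (\<eta> * \<pi>\<^sup>2 / 2)\<close>, the modulus of a holomorphic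
  function, because the argument of \<open>z - p\<close> varies by at most \<open>\<pi>\<close> there.\<close>

lemma fock_weight_log_perturbed_le:
  fixes s \<eta> :: real and p :: complex
  defines "\<phi> z \<equiv> s * ln (dist p z) - \<eta> / 2 * (ln (dist p z))\<^sup>2"
  assumes "0 < \<alpha>" "0 < C" "\<alpha> * C\<^sup>2 < real n" "0 \<le> \<eta>" "q holomorphic_on UNIV"
    and p: "sqrt (real n / \<alpha>) \<le> dist a p"
    and z: "dist a w < sqrt (real n / \<alpha>) - C"
    and S: "\<And>z. z \<noteq> p \<Longrightarrow> fock_weight \<alpha> (\<lambda>z. (z - a) ^ n * q z) z * exp (\<phi> z) \<le> S"
  shows "fock_weight \<alpha> (\<lambda>z. (z - a) ^ n * q z) w * exp (\<phi> w) \<le>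
    S * exp (\<eta> * pi\<^sup>2 / 2 - \<alpha> * C\<^sup>2 / 8)"
proof -
  define \<rho> where "\<rho> = sqrt (real n / \<alpha>)"
  have \<rho>: "\<alpha> * \<rho>\<^sup>2 = real n"
    using \<open>0 < \<alpha>\<close> by (simp add: \<rho>_def)
  then have "C\<^sup>2 < \<rho>\<^sup>2"
    using assms by (metis mult_less_cancel_left_pos)
  then have "C < \<rho>"
    by (rule power2_less_imp_less) (use \<open>0 < \<alpha>\<close> in \<open>simp add: \<rho>_def\<close>)
  \<comment> \<open>A branch of the logarithm of \<open>z - p\<close>, normalised to vanish at
    \<open>a\<close>. Points of the disc are closer to \<open>a\<close> than \<open>p\<close> is, so
    the quotient stays in the right half-plane, where \<open>Ln\<close> is holomorphic.\<close>
  define \<zeta> where "\<zeta> z = Ln ((z - p) / (a - p))" for z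
  have near: "z \<noteq> p \<and> a \<noteq> p \<and> 0 < Re ((z - p) / (a - p))" if "dist a z < \<rho>" for z
  proof -
    have less: "dist a z < dist a p"
      using that p by (simp add: \<rho>_def)
    then have "a \<noteq> p" by auto
    then have eq: "(z - p) / (a - p) = 1 - (a - z) / (a - p)"
      by (simp add: field_simps)
    have "cmod ((a - z) / (a - p)) < 1"
      using less \<open>a \<noteq> p\<close> by (simp add: norm_divide dist_norm)
    then have "Re ((a - z) / (a - p)) < 1"
      using complex_Re_le_cmod le_less_trans by blast
    then show ?thesis
      using less \<open>a \<noteq> p\<close> by (auto simp: eq)
  qed
  have \<zeta>_Re: "Re (\<zeta> z) = ln (dist p z) - ln (dist p a)" if "dist a z < \<rho>" for z
    using near[OF that]
    by (auto simp: \<zeta>_def norm_divide ln_div dist_norm norm_minus_commute)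
  have \<zeta>_Im: "\<bar>Im (\<zeta> z)\<bar> < pi / 2" if "dist a z < \<rho>" for z
    unfolding \<zeta>_def using near[OF that] by (subst Re_Ln_pos_lt) auto
  have \<zeta>_holo: "\<zeta> holomorphic_on ball a \<rho>"
    unfolding \<zeta>_def using near
    by (intro holomorphic_intros) (auto simp: complex_nonpos_Reals_iff less_le_not_le)
  have w: "dist a w < \<rho>"
    using z \<open>0 < C\<close> by (simp add: \<rho>_def)
  define t where "t = ln (dist p w)"
  define u where "u z = \<zeta> z - \<zeta> w" for z
  \<comment> \<open>The real part of \<open>u\<^sup>2\<close> is
    \<open>(Re u)\<^sup>2 - (Im u)\<^sup>2\<close>, so \<open>cmod (h z)\<close> is
    \<open>exp (\<phi> z - \<phi> w)\<close> up to an error governed by \<open>Im u\<close>. The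
    shift by \<open>\<zeta> w\<close> gives \<open>h w = 1\<close>.\<close>
  define h where "h z = exp (of_real s * u z - of_real (\<eta> / 2) * ((u z)\<^sup>2 + 2 * of_real t * u z))" for z
  have h_norm: "cmod (h z) = exp (\<phi> z - \<phi> w + \<eta> / 2 * (Im (u z))\<^sup>2)" if "dist a z < \<rho>" for z
  proof -
    have "ln (dist p z) = t + Re (u z)"
      using \<zeta>_Re[OF that] \<zeta>_Re[OF w] by (simp add: u_def t_def)
    then have "Re (of_real s * u z - of_real (\<eta> / 2) * ((u z)\<^sup>2 + 2 * of_real t * u z)) =
        \<phi> z - \<phi> w + \<eta> / 2 * (Im (u z))\<^sup>2"
      unfolding \<phi>_def t_def [symmetric] by (simp add: power2_eq_square field_simps)
    then show ?thesis
      by (simp only: h_def norm_exp_eq_Re)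
  qed
  \<comment> \<open>Since \<open>h\<close> is only known on the open disc, half of the margin
    \<open>C\<close> is spent on shrinking the circle. The remaining depth \<open>C / 2\<close>
    yields the gain \<open>\<alpha> * C\<^sup>2 / 8\<close>.\<close>
  have "fock_weight \<alpha> (\<lambda>z. (z - a) ^ n * q z) w * cmod (h w) \<le>
      S * exp (\<eta> * pi\<^sup>2 / 2 - \<phi> w) * exp (- (\<alpha> / 2) * (\<rho> - C / 2 - dist a w)\<^sup>2)"
  proof (rule fock_weight_disc_le[where R = \<rho>])
    show "0 < \<rho> - C / 2" "\<rho> - C / 2 < \<rho>" "dist a w \<le> \<rho> - C / 2"
      using \<open>0 < C\<close> \<open>C < \<rho>\<close> z by (auto simp: \<rho>_def)
    have "(\<rho> - C / 2)\<^sup>2 \<le> \<rho>\<^sup>2"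
      using \<open>0 < C\<close> \<open>C < \<rho>\<close> by (intro power_mono) auto
    then show "\<alpha> * (\<rho> - C / 2)\<^sup>2 \<le> real n"
      using \<open>0 < \<alpha>\<close> by (simp flip: \<rho>)
    show "h holomorphic_on ball a \<rho>"
      unfolding h_def u_def using \<zeta>_holo by (intro holomorphic_intros)
    show "fock_weight \<alpha> (\<lambda>z. (z - a) ^ n * q z) z * cmod (h z) \<le> S * exp (\<eta> * pi\<^sup>2 / 2 - \<phi> w)"
      if "dist a z = \<rho> - C / 2" for z
    proof -
      have z': "dist a z < \<rho>"
        using that \<open>0 < C\<close> by simp
      have "\<bar>Im (u z)\<bar> \<le> pi"
        using \<zeta>_Im[OF z'] \<zeta>_Im[OF w] by (simp add: u_def)
      then have "(Im (u z))\<^sup>2 \<le> pi\<^sup>2"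
        using abs_le_square_iff[of "Im (u z)" pi] by simp
      then have "\<eta> / 2 * (Im (u z))\<^sup>2 \<le> \<eta> * pi\<^sup>2 / 2"
        using \<open>0 \<le> \<eta>\<close> by (simp add: mult_left_mono)
      then have "cmod (h z) \<le> exp (\<phi> z) * exp (\<eta> * pi\<^sup>2 / 2 - \<phi> w)"
        unfolding h_norm[OF z'] exp_add [symmetric] by simp
      then have "fock_weight \<alpha> (\<lambda>z. (z - a) ^ n * q z) z * cmod (h z) \<le>
          fock_weight \<alpha> (\<lambda>z. (z - a) ^ n * q z) z * (exp (\<phi> z) * exp (\<eta> * pi\<^sup>2 / 2 - \<phi> w))"
        by (intro mult_left_mono fock_weight_nonneg)
      also have "\<dots> \<le> S * exp (\<eta> * pi\<^sup>2 / 2 - \<phi> w)"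
        unfolding mult.assoc [symmetric] using near[OF z'] by (intro mult_right_mono S) auto
      finally show ?thesis .
    qed
  qed (use assms in auto)
  also have "cmod (h w) = 1"
    by (simp add: h_def u_def)
  finally have "fock_weight \<alpha> (\<lambda>z. (z - a) ^ n * q z) w * exp (\<phi> w) \<le>
      S * exp (\<eta> * pi\<^sup>2 / 2 - \<phi> w) * exp (- (\<alpha> / 2) * (\<rho> - C / 2 - dist a w)\<^sup>2) * exp (\<phi> w)"
    by (simp add: mult_right_mono)
  also have "\<dots> = S * exp (\<eta> * pi\<^sup>2 / 2 - \<alpha> / 2 * (\<rho> - C / 2 - dist a w)\<^sup>2)"
    by (simp add: mult.assoc flip: exp_add)
  also have "\<dots> \<le> S * exp (\<eta> * pi\<^sup>2 / 2 - \<alpha> * C\<^sup>2 / 8)"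
  proof (intro mult_left_mono)
    have "(C / 2)\<^sup>2 \<le> (\<rho> - C / 2 - dist a w)\<^sup>2"
      using z \<open>0 < C\<close> by (intro power_mono) (auto simp: \<rho>_def)
    then have "\<alpha> / 2 * (C / 2)\<^sup>2 \<le> \<alpha> / 2 * (\<rho> - C / 2 - dist a w)\<^sup>2"
      using \<open>0 < \<alpha>\<close> by (intro mult_left_mono) auto
    then show "exp (\<eta> * pi\<^sup>2 / 2 - \<alpha> / 2 * (\<rho> - C / 2 - dist a w)\<^sup>2) \<le> exp (\<eta> * pi\<^sup>2 / 2 - \<alpha> * C\<^sup>2 / 8)"
      by (simp add: power_divide)
    show "0 \<le> S"
      using S[of w] near[OF w] mult_nonneg_nonneg[OF fock_weight_nonneg exp_ge_zero] order_trans by blast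
  qed
  finally show ?thesis .
qed

lemma fock_weight_continuous:
  assumes "f holomorphic_on UNIV"
  shows "continuous_on A (fock_weight \<alpha> f)"
  unfolding fock_weight_def
  using holomorphic_on_imp_continuous_on[OF assms]
  by (intro continuous_intros) (auto intro: continuous_on_subset)

text \<open>A supremum that the discs bound by a fixed fraction of itself must come from
  \<open>K\<close>. This is used twice: with the plain weight, to find \<open>p\<close>, and then
  with the logarithmic factor centred at \<open>p\<close>.\<close>

lemma fock_uniqueness:
  assumes "0 < \<alpha>" "0 < C" "compact K" "f holomorphic_on UNIV"
    and bound: "\<And>z. fock_weight \<alpha> f z \<le> B"
    and cover: "\<And>z. z \<notin> K \<Longrightarrow> \<exists>a\<in>\<Lambda>. \<alpha> * C\<^sup>2 < real (m a) \<and> dist a z < sqrt (real (m a) / \<alpha>) - C"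
    and zeros: "\<And>a. a \<in> \<Lambda> \<Longrightarrow> \<exists>q. q holomorphic_on UNIV \<and> f = (\<lambda>z. (z - a) ^ m a * q z)"
  shows "f z = 0"
proof (rule ccontr)
  assume "f z \<noteq> 0"
  have large: "1 \<le> m a" if "\<alpha> * C\<^sup>2 < real (m a)" for a
  proof -
    have "0 < \<alpha> * C\<^sup>2" using assms by simp
    then show ?thesis using that by linarith
  qed
  have centre: "fock_weight \<alpha> f z \<le> A * exp (- (\<alpha> / 2) * (sqrt (real (m a) / \<alpha>) - dist a z)\<^sup>2)"
    if "a \<in> \<Lambda>" "\<alpha> * C\<^sup>2 < real (m a)" "dist a z \<le> sqrt (real (m a) / \<alpha>)"
      "\<And>z. fock_weight \<alpha> f z \<le> A" for a z A
    using zeros[OF that(1)] fock_weight_centre_le[OF assms(1) large[OF that(2)], where z = z and a = a] that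
    by fastforce
  define M where "M = (SUP z. fock_weight \<alpha> f z)"
  have bdd: "bdd_above (range (fock_weight \<alpha> f))"
    using bound by (intro bdd_aboveI2)
  have M: "fock_weight \<alpha> f z \<le> M" for z
    unfolding M_def using bdd by (intro cSUP_upper) auto
  have "0 < fock_weight \<alpha> f z"
    using \<open>f z \<noteq> 0\<close> fock_weight_nonneg[of \<alpha> f z] fock_weight_eq_0_iff[of \<alpha> f z] by linarith
  then have "0 < M"
    using M[of z] by linarith
  define \<delta> where "\<delta> = exp (- (\<alpha> / 2) * C\<^sup>2)"
  have "M * \<delta> < M"
    using \<open>0 < M\<close> assms by (simp add: \<delta>_def)
  have off: "fock_weight \<alpha> f z \<le> M * \<delta>" if z: "z \<notin> K" for z
  proof -
    obtain a where a: "a \<in> \<Lambda>" "\<alpha> * C\<^sup>2 < real (m a)" "dist a z < sqrt (real (m a) / \<alpha>) - C"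
      using cover[OF z] by blast
    then have "fock_weight \<alpha> f z \<le> M * exp (- (\<alpha> / 2) * (sqrt (real (m a) / \<alpha>) - dist a z)\<^sup>2)"
      using \<open>0 < C\<close> M by (intro centre) auto
    also have "\<dots> \<le> M * \<delta>"
      unfolding \<delta>_def using \<open>0 < M\<close> a \<open>0 < C\<close> \<open>0 < \<alpha>\<close> by (auto intro!: mult_left_mono power_mono)
    finally show ?thesis .
  qed
  \<comment> \<open>With \<open>K\<close> empty, the discs alone would bound \<open>M\<close> by a
    fraction of itself.\<close>
  have "K \<noteq> {}"
  proof
    assume "K = {}"
    then have "M \<le> M * \<delta>"
      unfolding M_def[symmetric] by (subst M_def) (use off in \<open>auto intro!: cSUP_least\<close>)
    then show False using \<open>M * \<delta> < M\<close> by simp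
  qed
  then obtain p where "p \<in> K" and p: "\<And>z. z \<in> K \<Longrightarrow> fock_weight \<alpha> f z \<le> fock_weight \<alpha> f p"
    using continuous_attains_sup[OF \<open>compact K\<close> _ fock_weight_continuous[OF assms(4)], of \<alpha>] by blast
  have "M \<le> max (fock_weight \<alpha> f p) (M * \<delta>)"
    by (subst M_def, rule cSUP_least) (use p off in \<open>auto simp: le_max_iff_disj\<close>)
  then have "M \<le> fock_weight \<alpha> f p"
    using \<open>M * \<delta> < M\<close> by auto
  \<comment> \<open>The value at \<open>p\<close> is the supremum \<open>M\<close>, so positive
    depth inside a disc would force it strictly below \<open>M\<close>.\<close>
  have far: "sqrt (real (m a) / \<alpha>) \<le> dist a p" if a: "a \<in> \<Lambda>" "\<alpha> * C\<^sup>2 < real (m a)" for a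
  proof (rule ccontr)
    assume *: "\<not> sqrt (real (m a) / \<alpha>) \<le> dist a p"
    then have "M \<le> M * exp (- (\<alpha> / 2) * (sqrt (real (m a) / \<alpha>) - dist a p)\<^sup>2)"
      using order_trans[OF \<open>M \<le> fock_weight \<alpha> f p\<close> centre[OF a _ M]] by simp
    then show False
      using \<open>0 < M\<close> \<open>0 < \<alpha>\<close> * by (simp add: mult_le_0_iff)
  qed
  \<comment> \<open>Makes the cost \<open>\<eta> * pi\<^sup>2 / 2\<close> equal to
    \<open>\<alpha> * C\<^sup>2 / 16\<close>, half of the gain on the discs.\<close>
  define \<eta> where "\<eta> = \<alpha> * C\<^sup>2 / (8 * pi\<^sup>2)"
  define \<phi> where "\<phi> s z = s * ln (dist p z) - \<eta> / 2 * (ln (dist p z))\<^sup>2" for s z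
  have "0 < \<eta>" using assms by (simp add: \<eta>_def)
  obtain R where "0 < R" and R: "\<And>z. z \<in> K \<Longrightarrow> dist p z \<le> R"
    using compact_imp_bounded[OF \<open>compact K\<close>] bounded_any_center[of K p]
    by (metis less_le_not_le linear order_trans zero_less_one)
  \<comment> \<open>By the identity theorem \<open>f\<close> cannot vanish on the whole exterior of
    a ball. The factor \<open>exp 1\<close> puts \<open>ln (dist p w)\<close> at least 1 above
    \<open>ln R\<close>.\<close>
  obtain w where w: "f w \<noteq> 0" "R * exp 1 < dist p w"
  proof -
    have "\<exists>w. f w \<noteq> 0 \<and> R * exp 1 < dist p w"
    proof (rule ccontr)
      assume "\<nexists>w. f w \<noteq> 0 \<and> R * exp 1 < dist p w"
      then have *: "f w = 0" if "w \<in> - cball p (R * exp 1)" for w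
        using that by auto
      define c where "c = p - of_real (R * exp 1 + 1)"
      have c: "c \<in> - cball p (R * exp 1)"
        using \<open>0 < R\<close> by (simp add: c_def dist_norm del: of_real_add of_real_mult)
      have "f z = 0"
        by (rule analytic_continuation_open[of "- cball p (R * exp 1)" UNIV f "\<lambda>_. 0"])
          (use c * assms(4) in auto)
      then show False using \<open>f z \<noteq> 0\<close> by simp
    qed
    then show thesis using that by blast
  qed
  have "w \<noteq> p"
    using w(2) mult_pos_pos[OF \<open>0 < R\<close> exp_gt_zero[of 1]] by auto
  have growth: "fock_weight \<alpha> f w * exp (\<phi> s w) \<le> M * exp (s * ln R)" if "0 \<le> s" for s
  proof -
    \<comment> \<open>The point \<open>p\<close> is left out because the formula at
      \<open>ln 0\<close> does not give the intended limit value 0.\<close>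
    define S where "S = (SUP z\<in>-{p}. fock_weight \<alpha> f z * exp (\<phi> s z))"
    \<comment> \<open>Completing the square in \<open>ln (dist p z)\<close>: the quadratic term
      keeps \<open>S\<close> finite.\<close>
    have \<phi>_le: "\<phi> s z \<le> s\<^sup>2 / (2 * \<eta>)" for z
    proof -
      have "0 \<le> (s - \<eta> * ln (dist p z))\<^sup>2" by simp
      then show ?thesis
        using \<open>0 < \<eta>\<close> by (simp add: \<phi>_def field_simps power2_eq_square)
    qed
    have "bdd_above ((\<lambda>z. fock_weight \<alpha> f z * exp (\<phi> s z)) ` (-{p}))"
    proof (rule bdd_aboveI2)
      show "fock_weight \<alpha> f z * exp (\<phi> s z) \<le> M * exp (s\<^sup>2 / (2 * \<eta>))" for z
        using M \<phi>_le \<open>0 < M\<close> by (intro mult_mono) auto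
    qed
    then have S: "fock_weight \<alpha> f z * exp (\<phi> s z) \<le> S" if "z \<noteq> p" for z
      unfolding S_def using that by (intro cSUP_upper) auto
    have "0 < fock_weight \<alpha> f w"
      using w fock_weight_nonneg[of \<alpha> f w] fock_weight_eq_0_iff[of \<alpha> f w] by linarith
    then have "0 < S"
      using S[OF \<open>w \<noteq> p\<close>] by (smt (verit) exp_gt_zero mult_pos_pos)
    define \<theta> where "\<theta> = exp (\<eta> * pi\<^sup>2 / 2 - \<alpha> * C\<^sup>2 / 8)"
    have "\<eta> * pi\<^sup>2 / 2 - \<alpha> * C\<^sup>2 / 8 < 0"
      using assms by (simp add: \<eta>_def)
    then have "S * \<theta> < S"
      using \<open>0 < S\<close> by (simp add: \<theta>_def)
    have "fock_weight \<alpha> f z * exp (\<phi> s z) \<le> max (M * exp (s * ln R)) (S * \<theta>)" if "z \<noteq> p" for z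
    proof (cases "z \<in> K")
      case True
      have "ln (dist p z) \<le> ln R"
        using R[OF True] that by (subst ln_le_cancel_iff) (auto simp: \<open>0 < R\<close>)
      then have "s * ln (dist p z) \<le> s * ln R"
        using \<open>0 \<le> s\<close> by (rule mult_left_mono)
      moreover have "0 \<le> \<eta> / 2 * (ln (dist p z))\<^sup>2"
        using \<open>0 < \<eta>\<close> by simp
      ultimately have "\<phi> s z \<le> s * ln R"
        by (simp add: \<phi>_def)
      then have "fock_weight \<alpha> f z * exp (\<phi> s z) \<le> M * exp (s * ln R)"
        using M \<open>0 < M\<close> by (intro mult_mono) auto
      then show ?thesis by simp
    next
      case False
      then obtain a where a: "a \<in> \<Lambda>" "\<alpha> * C\<^sup>2 < real (m a)" "dist a z < sqrt (real (m a) / \<alpha>) - C"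
        using cover by blast
      obtain q where q: "q holomorphic_on UNIV" "f = (\<lambda>z. (z - a) ^ m a * q z)"
        using zeros[OF a(1)] by blast
      have "fock_weight \<alpha> f z * exp (\<phi> s z) \<le> S * \<theta>"
        unfolding \<theta>_def \<phi>_def q(2)
        by (rule fock_weight_log_perturbed_le)
          (use assms a q far[OF a(1,2)] \<open>0 < \<eta>\<close> S in \<open>auto simp: \<phi>_def\<close>)
      then show ?thesis by simp
    qed
    then have "S \<le> max (M * exp (s * ln R)) (S * \<theta>)"
      using \<open>w \<noteq> p\<close> by (subst S_def, intro cSUP_least) auto
    then have "S \<le> M * exp (s * ln R)"
      using \<open>S * \<theta> < S\<close> by auto
    then show ?thesis
      using S[OF \<open>w \<noteq> p\<close>] by linarith
  qed
  define t where "t = ln (dist p w)"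
  have "ln (R * exp 1) < t"
    unfolding t_def using w(2) \<open>w \<noteq> p\<close> \<open>0 < R\<close> by (subst ln_less_cancel_iff) auto
  then have t: "1 + ln R \<le> t"
    using \<open>0 < R\<close> by (simp add: ln_mult)
  \<comment> \<open>Isolates the part of the left side of \<open>growth\<close> that is independent
    of \<open>s\<close>; what remains grows like \<open>exp (s * t)\<close>, faster than
    \<open>exp (s * ln R)\<close>.\<close>
  define c where "c = fock_weight \<alpha> f w * exp (- (\<eta> / 2 * t\<^sup>2))"
  have "0 < c"
    using w fock_weight_nonneg[of \<alpha> f w] fock_weight_eq_0_iff[of \<alpha> f w] by (simp add: c_def)
  have "c * exp s \<le> M" if "0 \<le> s" for s
  proof -
    have "s * (1 + ln R) \<le> s * t"
      using t that by (rule mult_left_mono)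
    then have "exp s * exp (s * ln R) \<le> exp (s * t)"
      by (simp add: algebra_simps flip: exp_add)
    then have "c * (exp s * exp (s * ln R)) \<le> c * exp (s * t)"
      using \<open>0 < c\<close> by simp
    also have "\<dots> = fock_weight \<alpha> f w * exp (\<phi> s w)"
      by (simp add: c_def \<phi>_def t_def mult.assoc flip: exp_add)
    also have "\<dots> \<le> M * exp (s * ln R)"
      using that by (rule growth)
    finally show ?thesis
      by (simp add: mult.assoc [symmetric])
  qed
  from this[of "M / c"] have "exp (M / c) \<le> M / c"
    using \<open>0 < c\<close> \<open>0 < M\<close> by (simp add: field_simps)
  then show False
    using exp_gt_self[of "M / c"] by simp
qed

subsection \<open>Normal families\<close>

lemma fock_weight_divide:
  assumes "0 < c"
  shows "fock_weight \<alpha> (\<lambda>z. f z / of_real c) z = fock_weight \<alpha> f z / c"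
  using assms by (simp add: fock_weight_def norm_divide)

text \<open>Failure of the sampling inequality with \<open>L = Suc n\<close>, after scaling to norm
  1. The third property says that the supremum is 1 without claiming that it is attained.\<close>

lemma not_sampling_divisor_sequence:
  assumes "\<not> sampling_divisor \<alpha> \<Lambda> m"
  obtains f :: "nat \<Rightarrow> complex \<Rightarrow> complex" where
    "\<And>n. f n holomorphic_on UNIV"
    "\<And>n z. fock_weight \<alpha> (f n) z \<le> 1"
    "\<And>n b. b < 1 \<Longrightarrow> \<exists>z. b < fock_weight \<alpha> (f n) z"
    "\<And>n a. a \<in> \<Lambda> \<Longrightarrow> \<exists>q. q holomorphic_on UNIV \<and>
      (\<forall>z. fock_weight \<alpha> (\<lambda>z. f n z - (z - a) ^ m a * q z) z \<le> inverse (real (Suc n)))"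
proof -
  let ?P = "\<lambda>n f. f holomorphic_on UNIV \<and> (\<forall>z. fock_weight \<alpha> f z \<le> 1) \<and>
      (\<forall>b<1. \<exists>z. b < fock_weight \<alpha> f z) \<and>
      (\<forall>a\<in>\<Lambda>. \<exists>q. q holomorphic_on UNIV \<and>
        (\<forall>z. fock_weight \<alpha> (\<lambda>z. f z - (z - a) ^ m a * q z) z \<le> inverse (real (Suc n))))"
  have "\<exists>f. ?P n f" for n
  proof -
    define L where "L = real (Suc n)"
    have "0 < L" by (simp add: L_def)
    obtain F where F: "F \<in> fock_space \<alpha>"
      and gap: "ennreal L * (SUP a\<in>\<Lambda>. fock_quotient_norm \<alpha> a (m a) F) < fock_norm \<alpha> F"
      using assms \<open>0 < L\<close> unfolding sampling_divisor_def by (metis not_le)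
    define c where "c = enn2real (fock_norm \<alpha> F)"
    have c: "fock_norm \<alpha> F = ennreal c"
      using F by (simp add: c_def fock_space_def)
    have "0 < c"
      using gap unfolding c by (metis ennreal_eq_0_iff not_le not_less_zero)
    have F_holo: "F holomorphic_on UNIV"
      using F by (simp add: fock_space_def)
    define f where "f z = F z / of_real c" for z
    have weight: "fock_weight \<alpha> f z = fock_weight \<alpha> F z / c" for z
      unfolding f_def using \<open>0 < c\<close> by (rule fock_weight_divide)
    have "f holomorphic_on UNIV"
      unfolding f_def using F_holo \<open>0 < c\<close> by (intro holomorphic_intros) auto
    moreover have "fock_weight \<alpha> f z \<le> 1" for z
      using fock_norm_le_iff[of c \<alpha> F] c \<open>0 < c\<close> by (simp add: weight)
    moreover have "\<exists>z. b < fock_weight \<alpha> f z" if "b < 1" for b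
    proof (rule ccontr)
      assume "\<nexists>z. b < fock_weight \<alpha> f z"
      then have *: "fock_weight \<alpha> f z \<le> b" for z
        by (simp add: not_less)
      then have "0 \<le> b"
        using fock_weight_nonneg order_trans by blast
      have "fock_weight \<alpha> F z \<le> b * c" for z
        using *[of z] \<open>0 < c\<close> by (simp add: weight field_simps)
      then have "ennreal c \<le> ennreal (b * c)"
        using \<open>0 \<le> b\<close> \<open>0 < c\<close> by (simp add: fock_norm_le_iff flip: c)
      then show False
        using \<open>0 \<le> b\<close> \<open>0 < c\<close> that by simp
    qed
    moreover have "\<exists>q. q holomorphic_on UNIV \<and>
        (\<forall>z. fock_weight \<alpha> (\<lambda>z. f z - (z - a) ^ m a * q z) z \<le> inverse L)" if "a \<in> \<Lambda>" for a
    proof -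
      \<comment> \<open>Strictness is needed so that an actual element \<open>g\<close> undercuts
        the bound, as the infimum need not be attained.\<close>
      have "fock_quotient_norm \<alpha> a (m a) F < ennreal (c / L)"
      proof (rule ccontr)
        assume "\<not> fock_quotient_norm \<alpha> a (m a) F < ennreal (c / L)"
        then have "ennreal (c / L) \<le> (SUP a\<in>\<Lambda>. fock_quotient_norm \<alpha> a (m a) F)"
          using \<open>a \<in> \<Lambda>\<close> by (meson SUP_upper2 not_less)
        then have "ennreal L * ennreal (c / L) \<le> ennreal L * (SUP a\<in>\<Lambda>. fock_quotient_norm \<alpha> a (m a) F)"
          by (rule mult_left_mono) simp
        moreover have "ennreal L * ennreal (c / L) = ennreal c"
          using \<open>0 < L\<close> \<open>0 < c\<close> by (simp flip: ennreal_mult)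
        ultimately show False
          using gap c by simp
      qed
      then obtain g where g: "g \<in> vanishing_subspace \<alpha> a (m a)"
        and g_close: "fock_norm \<alpha> (\<lambda>z. F z - g z) < ennreal (c / L)"
        unfolding fock_quotient_norm_def INF_less_iff by blast
      then have diff: "fock_weight \<alpha> (\<lambda>z. F z - g z) z \<le> c / L" for z
        using fock_norm_le_iff[of "c / L" \<alpha> "\<lambda>z. F z - g z"] less_imp_le[OF g_close] \<open>0 < c\<close> \<open>0 < L\<close>
        by simp
      have "g holomorphic_on UNIV"
        using g by (simp add: vanishing_subspace_def fock_space_def)
      then obtain q where q: "q holomorphic_on UNIV" and
        "\<And>z. g z = (\<Sum>k<m a. (deriv ^^ k) g a / fact k * (z - a) ^ k) + (z - a) ^ m a * q z"
        by (rule entire_taylor_remainder[where a = a and n = "m a"]) (rule that)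
      then have g_eq: "g z = (z - a) ^ m a * q z" for z
        using g by (simp add: vanishing_subspace_def)
      define Q where "Q z = q z / of_real c" for z
      have "Q holomorphic_on UNIV"
        unfolding Q_def using q \<open>0 < c\<close> by (intro holomorphic_intros) auto
      moreover have "fock_weight \<alpha> (\<lambda>z. f z - (z - a) ^ m a * Q z) z \<le> inverse L" for z
      proof -
        have "fock_weight \<alpha> (\<lambda>z. f z - (z - a) ^ m a * Q z) z =
            fock_weight \<alpha> (\<lambda>z. (F z - g z) / of_real c) z"
          by (simp add: f_def Q_def g_eq diff_divide_distrib)
        also have "\<dots> \<le> inverse L"
          using diff[of z] \<open>0 < c\<close> \<open>0 < L\<close> by (simp add: fock_weight_divide field_simps)
        finally show ?thesis .
      qed
      ultimately show ?thesis by blast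
    qed
    ultimately show ?thesis
      unfolding L_def by blast
  qed
  then have "\<exists>f. \<forall>n. ?P n (f n)"
    by (intro choice allI)
  then obtain f where f: "\<forall>n. ?P n (f n)" ..
  show thesis
    by (rule that[of f]) (use f in blast)+
qed

text \<open>A limit of the normalised counterexamples vanishes by \<open>fock_uniqueness\<close>, so
  they become small on \<open>K\<close>. Off \<open>K\<close> the discs keep their weight near
  \<open>\<delta> < 1\<close>, so no mass escapes to infinity and the norm cannot stay 1.\<close>

lemma covering_imp_sampling_divisor:
  assumes "0 < \<alpha>" "0 < C" "compact K"
    and cover: "\<And>z. z \<notin> K \<Longrightarrow> \<exists>a\<in>\<Lambda>. \<alpha> * C\<^sup>2 < real (m a) \<and> dist a z < sqrt (real (m a) / \<alpha>) - C"
  shows "sampling_divisor \<alpha> \<Lambda> m"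
proof (rule ccontr)
  assume "\<not> sampling_divisor \<alpha> \<Lambda> m"
  then obtain f where f: "\<And>n. f n holomorphic_on UNIV" "\<And>n z. fock_weight \<alpha> (f n) z \<le> 1"
      "\<And>n b. b < 1 \<Longrightarrow> \<exists>z. b < fock_weight \<alpha> (f n) z"
    and approx: "\<And>n a. a \<in> \<Lambda> \<Longrightarrow> \<exists>q. q holomorphic_on UNIV \<and>
      (\<forall>z. fock_weight \<alpha> (\<lambda>z. f n z - (z - a) ^ m a * q z) z \<le> inverse (real (Suc n)))"
    by (rule not_sampling_divisor_sequence) (rule that)
  have norm_le: "cmod (u z) \<le> A * exp (\<alpha> / 2 * R\<^sup>2)"
    if "fock_weight \<alpha> u z \<le> A" "cmod z \<le> R" for u z A R
  proof -
    have "0 \<le> A"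
      using that(1) fock_weight_nonneg order_trans by blast
    have "cmod (u z) \<le> A * exp (\<alpha> / 2 * (cmod z)\<^sup>2)"
      using that(1) by (simp add: fock_weight_def exp_minus field_simps)
    also have "\<dots> \<le> A * exp (\<alpha> / 2 * R\<^sup>2)"
      using \<open>0 \<le> A\<close> \<open>0 < \<alpha>\<close> that(2) by (intro mult_left_mono) (auto intro!: power_mono)
    finally show ?thesis .
  qed
  obtain g r where g: "g holomorphic_on UNIV" and r: "strict_mono (r :: nat \<Rightarrow> nat)"
    and lim: "\<And>z. (\<lambda>n. f (r n) z) \<longlonglongrightarrow> g z"
    and unif: "\<And>A. compact A \<Longrightarrow> uniform_limit A (f \<circ> r) g sequentially"
  proof (rule Montel[of UNIV "range f" f])
    show "\<exists>B. \<forall>h\<in>range f. \<forall>z\<in>A. cmod (h z) \<le> B" if A: "compact A" for A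
    proof -
      obtain R where "\<And>z. z \<in> A \<Longrightarrow> cmod z \<le> R"
        using compact_imp_bounded[OF A] by (auto simp: bounded_iff)
      then show ?thesis
        using norm_le[OF f(2)] by (intro exI[of _ "1 * exp (\<alpha> / 2 * R\<^sup>2)"]) blast
    qed
  qed (use f(1) in auto)
  have eps: "(\<lambda>n. inverse (real (Suc (r n)))) \<longlonglongrightarrow> 0"
    using LIMSEQ_subseq_LIMSEQ[OF LIMSEQ_inverse_real_of_nat r] by (simp add: o_def)
  have "g z = 0" for z
  proof (rule fock_uniqueness[OF assms(1-3) g _ cover])
    show "fock_weight \<alpha> g z \<le> 1" for z
    proof (rule tendsto_upperbound)
      show "(\<lambda>n. fock_weight \<alpha> (f (r n)) z) \<longlonglongrightarrow> fock_weight \<alpha> g z"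
        unfolding fock_weight_def by (intro tendsto_intros lim)
    qed (use f(2) in auto)
    show "\<exists>q. q holomorphic_on UNIV \<and> g = (\<lambda>z. (z - a) ^ m a * q z)" if a: "a \<in> \<Lambda>" for a
    proof -
      obtain q where q: "\<And>n. q n holomorphic_on UNIV" "\<And>n z.
          fock_weight \<alpha> (\<lambda>z. f n z - (z - a) ^ m a * q n z) z \<le> inverse (real (Suc n))"
        using approx[OF a] by metis
      have "uniform_limit (ball a 1) (\<lambda>n z. f (r n) z - (z - a) ^ m a * q (r n) z) (\<lambda>_. 0) sequentially"
      proof (rule uniform_limitI)
        fix e :: real assume "0 < e"
        have "(\<lambda>n. inverse (real (Suc (r n))) * exp (\<alpha> / 2 * (cmod a + 1)\<^sup>2)) \<longlonglongrightarrow> 0"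
          using eps by (rule tendsto_mult_left_zero)
        then have "\<forall>\<^sub>F n in sequentially.
            inverse (real (Suc (r n))) * exp (\<alpha> / 2 * (cmod a + 1)\<^sup>2) < e"
          using \<open>0 < e\<close> by (rule order_tendstoD)
        then show "\<forall>\<^sub>F n in sequentially. \<forall>z\<in>ball a 1.
            dist (f (r n) z - (z - a) ^ m a * q (r n) z) 0 < e"
        proof eventually_elim
          case (elim n)
          have "cmod z \<le> cmod a + 1" if "z \<in> ball a 1" for z
            using that norm_triangle_sub[of z a] by (simp add: dist_norm norm_minus_commute)
          then have "cmod (f (r n) z - (z - a) ^ m a * q (r n) z) < e" if "z \<in> ball a 1" for z
            using le_less_trans[OF norm_le[OF q(2)] elim] that by simp
          then show ?case by simp
        qed
      qed
      moreover have "uniform_limit (ball a 1) (\<lambda>n. f (r n)) g sequentially"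
        using uniform_limit_on_subset[OF unif[OF compact_cball[of a 1]]] by (simp add: o_def)
      ultimately have "uniform_limit (ball a 1) (\<lambda>n z. f (r n) z - (f (r n) z - (z - a) ^ m a * q (r n) z))
          (\<lambda>z. g z - 0) sequentially"
        by (intro uniform_limit_minus)
      then have "uniform_limit (ball a 1) (\<lambda>n z. (z - a) ^ m a * q (r n) z) g sequentially"
        by simp
      then have deriv_lim: "(\<lambda>n. (deriv ^^ k) (\<lambda>z. (z - a) ^ m a * q (r n) z) a) \<longlonglongrightarrow> (deriv ^^ k) g a" for k
      proof (rule higher_deriv_complex_uniform_limit)
        have "(\<lambda>z. (z - a) ^ m a * q (r n) z) holomorphic_on ball a 1" for n
          using holomorphic_on_subset[OF q(1)] by (intro holomorphic_intros) simp
        then show "\<forall>\<^sub>F n in sequentially. (\<lambda>z. (z - a) ^ m a * q (r n) z) holomorphic_on ball a 1"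
          by simp
      qed simp_all
      have "(deriv ^^ k) g a = 0" if "k < m a" for k
        using deriv_lim[of k] by (simp add: higher_deriv_power_mult_eq_0[OF q(1) that] LIMSEQ_const_iff)
      moreover obtain h where "h holomorphic_on UNIV" and
        "\<And>z. g z = (\<Sum>k<m a. (deriv ^^ k) g a / fact k * (z - a) ^ k) + (z - a) ^ m a * h z"
        using g by (rule entire_taylor_remainder[where a = a and n = "m a"]) (rule that)
      ultimately have "g = (\<lambda>z. (z - a) ^ m a * h z)"
        by (simp add: fun_eq_iff)
      with \<open>h holomorphic_on UNIV\<close> show ?thesis by blast
    qed
  qed
  then have "g = (\<lambda>_. 0)" by blast
  then have zero_lim: "uniform_limit K (f \<circ> r) (\<lambda>_. 0) sequentially"
    using unif[OF \<open>compact K\<close>] by simp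
  define \<delta> where "\<delta> = exp (- (\<alpha> / 2) * C\<^sup>2)"
  have \<delta>: "0 < \<delta>" "\<delta> < 1"
    using assms(1,2) by (simp_all add: \<delta>_def)
  \<comment> \<open>The threshold is midway between \<open>\<delta>\<close> and 1; the tolerance
    \<open>(1 - \<delta>) / 4\<close> below makes \<open>\<delta> + 2 * \<epsilon>\<close> stay
    under it.\<close>
  have "\<forall>\<^sub>F n in sequentially. \<forall>z\<in>K. cmod (f (r n) z) < (1 + \<delta>) / 2"
    using uniform_limitD[OF zero_lim, of "(1 + \<delta>) / 2"] \<delta>
    by simp
  moreover have "\<forall>\<^sub>F n in sequentially. inverse (real (Suc (r n))) < (1 - \<delta>) / 4"
    using eps \<delta> by (intro order_tendstoD) auto
  ultimately have "\<forall>\<^sub>F n in sequentially. False"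
  proof eventually_elim
    case (elim n)
    define \<epsilon> where "\<epsilon> = inverse (real (Suc (r n)))"
    have "0 < \<epsilon>" by (simp add: \<epsilon>_def)
    have "fock_weight \<alpha> (f (r n)) z \<le> (1 + \<delta>) / 2" for z
    proof (cases "z \<in> K")
      case True
      have "fock_weight \<alpha> (f (r n)) z \<le> cmod (f (r n) z)"
        using \<open>0 < \<alpha>\<close> by (simp add: fock_weight_def mult_left_le)
      also have "\<dots> \<le> (1 + \<delta>) / 2"
        using elim(1) True by (intro less_imp_le) blast
      finally show ?thesis .
    next
      case False
      then obtain a where a: "a \<in> \<Lambda>" "\<alpha> * C\<^sup>2 < real (m a)" "dist a z < sqrt (real (m a) / \<alpha>) - C"
        using cover by blast
      obtain q where q: "q holomorphic_on UNIV"
        and close: "\<forall>z. fock_weight \<alpha> (\<lambda>z. f (r n) z - (z - a) ^ m a * q z) z \<le> \<epsilon>"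
        using approx[OF a(1), of "r n", folded \<epsilon>_def] by (elim exE conjE) (rule that)
      \<comment> \<open>The nearby function with the zero at \<open>a\<close>; the decay estimate
        applies to it, not to \<open>f (r n)\<close> itself, at the price of two errors of size
        \<open>\<epsilon>\<close>.\<close>
      define p where "p = (\<lambda>z. (z - a) ^ m a * q z)"
      have p_le: "fock_weight \<alpha> p z \<le> 1 + \<epsilon>" for z
        using fock_weight_add_le[of \<alpha> "f (r n)" "\<lambda>z. - (f (r n) z - p z)" z] f(2)[of "r n" z] spec[OF close, of z]
        by (simp add: fock_weight_def p_def norm_minus_commute)
      have "0 < \<alpha> * C\<^sup>2"
        using assms(1,2) by simp
      then have "1 \<le> m a"
        using a(2) by linarith
      then have "fock_weight \<alpha> p z \<le>
          (1 + \<epsilon>) * exp (- (\<alpha> / 2) * (sqrt (real (m a) / \<alpha>) - dist a z)\<^sup>2)"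
        unfolding p_def using assms(1,2) q p_le[unfolded p_def] a(3)
        by (intro fock_weight_centre_le) simp_all
      also have "\<dots> \<le> (1 + \<epsilon>) * \<delta>"
        unfolding \<delta>_def using a(3) assms(1,2) \<open>0 < \<epsilon>\<close> by (auto intro!: mult_left_mono power_mono)
      finally have "fock_weight \<alpha> (f (r n)) z \<le> \<epsilon> + (1 + \<epsilon>) * \<delta>"
        using fock_weight_add_le[of \<alpha> "\<lambda>z. f (r n) z - p z" p z] spec[OF close, of z] by (simp add: p_def)
      also have "\<dots> \<le> \<delta> + 2 * \<epsilon>"
        using \<delta> \<open>0 < \<epsilon>\<close> by (simp add: algebra_simps)
      also have "\<dots> \<le> (1 + \<delta>) / 2"
        using elim(2) by (simp add: \<epsilon>_def field_simps)
      finally show ?thesis .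
    qed
    moreover have "(1 + \<delta>) / 2 < 1"
      using \<delta> by simp
    ultimately show ?case
      using f(3)[of "(1 + \<delta>) / 2" "r n"] by (auto simp: not_less[symmetric])
  qed
  then show False by simp
qed

theorem theorem1p5:
  fixes \<alpha> :: real and \<Lambda> :: "complex set" and m :: "complex \<Rightarrow> nat"
  assumes "\<alpha> > 0" and "divisor \<Lambda> m"
  shows "(sampling_divisor \<alpha> \<Lambda> m \<longrightarrow>
            (\<exists>C>0. (\<Union>l\<in>\<Lambda>. ball l (sqrt (real (m l) / \<alpha>) + C)) = UNIV)) \<and>
         ((\<exists>C>0. \<exists>K. compact K \<and>
             (\<Union>l\<in>{l\<in>\<Lambda>. real (m l) > \<alpha> * C\<^sup>2}. ball l (sqrt (real (m l) / \<alpha>) - C)) = UNIV - K)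
           \<longrightarrow> sampling_divisor \<alpha> \<Lambda> m)"
proof (intro conjI impI)
  assume "sampling_divisor \<alpha> \<Lambda> m"
  with assms show "\<exists>C>0. (\<Union>l\<in>\<Lambda>. ball l (sqrt (real (m l) / \<alpha>) + C)) = UNIV"
    by (rule sampling_divisor_imp_covering)
next
  assume "\<exists>C>0. \<exists>K. compact K \<and>
    (\<Union>l\<in>{l\<in>\<Lambda>. real (m l) > \<alpha> * C\<^sup>2}. ball l (sqrt (real (m l) / \<alpha>) - C)) = UNIV - K"
  then obtain C K where "0 < C" "compact K" and
    cover: "(\<Union>l\<in>{l\<in>\<Lambda>. real (m l) > \<alpha> * C\<^sup>2}. ball l (sqrt (real (m l) / \<alpha>) - C)) = UNIV - K"
    by blast
  have "\<exists>l\<in>\<Lambda>. \<alpha> * C\<^sup>2 < real (m l) \<and> dist l z < sqrt (real (m l) / \<alpha>) - C" if "z \<notin> K" for z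
  proof -
    have "z \<in> UNIV - K" using that by simp
    then show ?thesis unfolding cover [symmetric] by auto
  qed
  then show "sampling_divisor \<alpha> \<Lambda> m"
    by (rule covering_imp_sampling_divisor[OF assms(1) \<open>0 < C\<close> \<open>compact K\<close>])
qed

end
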